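(* Let $\mathcal{A}$ be the set of all functions $f:\mathbb{N}\to\mathbb{C}$. Then the $\mathbb{C}$-algebras $(\mathcal{A},+,\circ,\mathbb{C})$ and $(\mathcal{A},+,*,\mathbb{C})$ are isomorphic, and the map $f\mapsto f/\xi$ (pointwise quotient) is an algebra isomorphism from the first onto the second. In particular $f\circ g=\xi\left(\frac{f}{\xi}*\frac{g}{\xi}\right)$ for all $f,g\in\mathcal{A}$.
   Context: For $n\in\mathbb{N}$ write $n=\prod_p p^{\nu_p(n)}$ (canonical prime factorization). The Dirichlet convolution is $(f*g)(n)=\sum_{d\mid n}f(d)g(n/d)$. The binomial convolution is $(f\circ g)(n)=\sum_{d\mid n}\left(\prod_p\binom{\nu_p(n)}{\nu_p(d)}\right)f(d)g(n/d)$. Both algebras use pointwise addition and pointwise scalar multiplication. The function $\xi:\mathbb{N}\to\mathbb{N}$ is $\xi(n)=\prod_p \nu_p(n)!$. *)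

theory Defs
  imports Complex_Main "HOL-Computational_Algebra.Primes"
    "HOL-Algebra.Algebraic_Closure_Type"
begin

text \<open>The set of all functions from the positive integers to the complex numbers. The
  functions are extensional (undefined at \<open>0\<close>), so that HOL equality of two of them is
  equality at every positive integer.\<close>

definition arith_funs :: "(nat \<Rightarrow> complex) set" where
  "arith_funs = {0<..} \<rightarrow>\<^sub>E UNIV"

definition dirichlet_conv :: "(nat \<Rightarrow> complex) \<Rightarrow> (nat \<Rightarrow> complex) \<Rightarrow> nat \<Rightarrow> complex" where
  "dirichlet_conv f g = (\<lambda>n\<in>{0<..}. \<Sum>d | d dvd n. f d * g (n div d))"

text \<open>The products below over all primes are taken over the prime divisors of \<open>n\<close>: for every
  other prime \<open>p\<close> the multiplicities of \<open>p\<close> in \<open>n\<close> and in its divisors are \<open>0\<close>, and the factor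
  is \<open>1\<close>.\<close>

definition binomial_conv :: "(nat \<Rightarrow> complex) \<Rightarrow> (nat \<Rightarrow> complex) \<Rightarrow> nat \<Rightarrow> complex" where
  "binomial_conv f g = (\<lambda>n\<in>{0<..}. \<Sum>d | d dvd n.
     of_nat (\<Prod>p\<in>prime_factors n. multiplicity p n choose multiplicity p d) * f d * g (n div d))"

definition xi :: "nat \<Rightarrow> nat" where
  "xi n = (\<Prod>p\<in>prime_factors n. fact (multiplicity p n))"

definition quot_xi :: "(nat \<Rightarrow> complex) \<Rightarrow> nat \<Rightarrow> complex" where
  "quot_xi f = (\<lambda>n\<in>{0<..}. f n / of_nat (xi n))"

definition times_xi :: "(nat \<Rightarrow> complex) \<Rightarrow> nat \<Rightarrow> complex" where
  "times_xi f = (\<lambda>n\<in>{0<..}. of_nat (xi n) * f n)"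

definition conv_algebra ::
  "((nat \<Rightarrow> complex) \<Rightarrow> (nat \<Rightarrow> complex) \<Rightarrow> nat \<Rightarrow> complex) \<Rightarrow> (complex, nat \<Rightarrow> complex) module" where
  "conv_algebra conv =
     \<lparr>carrier = arith_funs,
      monoid.mult = conv,
      one = (\<lambda>n\<in>{0<..}. if n = 1 then 1 else 0),
      ring.zero = (\<lambda>n\<in>{0<..}. 0),
      add = (\<lambda>f g. \<lambda>n\<in>{0<..}. f n + g n),
      module.smult = (\<lambda>c f. \<lambda>n\<in>{0<..}. c * f n)\<rparr>"

abbreviation complex_ring :: "complex ring" where
  "complex_ring \<equiv> ring_of_type_algebra"

definition binomial_algebra :: "(complex, nat \<Rightarrow> complex) module" where
  "binomial_algebra = conv_algebra binomial_conv"

definition dirichlet_algebra :: "(complex, nat \<Rightarrow> complex) module" where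
  "dirichlet_algebra = conv_algebra dirichlet_conv"

definition algebra_iso ::
  "('r, 'm) ring_scheme \<Rightarrow> ('r, 'a, 'n) module_scheme \<Rightarrow> ('r, 'b, 'k) module_scheme \<Rightarrow> ('a \<Rightarrow> 'b) set" where
  "algebra_iso R A B =
     {h \<in> ring_iso A B. \<forall>c\<in>carrier R. \<forall>x\<in>carrier A. h (c \<odot>\<^bsub>A\<^esub> x) = c \<odot>\<^bsub>B\<^esub> h x}"

definition isomorphic_algebras ::
  "('r, 'm) ring_scheme \<Rightarrow> ('r, 'a, 'n) module_scheme \<Rightarrow> ('r, 'b, 'k) module_scheme \<Rightarrow> bool" where
  "isomorphic_algebras R A B \<longleftrightarrow> algebra R A \<and> algebra R B \<and> algebra_iso R A B \<noteq> {}"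

end

(* The weight of binomial convolution is a multinomial quotient:
   prod_p (nu_p(n) choose nu_p(d)) = xi(n) / (xi(d) xi(n/d)) whenever d divides n.
   Hence division by xi turns binomial convolution into Dirichlet convolution. As xi never
   vanishes, this is an invertible linear map, and the ring axioms carry over from the Dirichlet
   algebra, where they are rearrangements of sums over factorizations. *)

theory Submission
  imports Defs
begin

text \<open>Both functions are \<open>undefined\<close> at 0, so that argument needs no
  check.\<close>

lemma arith_funs_eqI:
  assumes "f \<in> arith_funs" "g \<in> arith_funs" "\<And>n. n > 0 \<Longrightarrow> f n = g n"
  shows "f = g"
  using assms unfolding arith_funs_def by (intro PiE_ext) auto

lemma restrict_in_arith_funs [simp]: "(\<lambda>n\<in>{0<..}. F n) \<in> arith_funs"
  by (auto simp: arith_funs_def)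

lemma dirichlet_conv_in_arith_funs [simp]: "dirichlet_conv f g \<in> arith_funs"
  and binomial_conv_in_arith_funs [simp]: "binomial_conv f g \<in> arith_funs"
  and quot_xi_in_arith_funs [simp]: "quot_xi f \<in> arith_funs"
  and times_xi_in_arith_funs [simp]: "times_xi f \<in> arith_funs"
  by (simp_all add: dirichlet_conv_def binomial_conv_def quot_xi_def times_xi_def)

text \<open>Treats the two factors symmetrically, which turns commutativity and associativity into
  reindexings of finite sums. For n > 0, a pair is determined by its first entry.\<close>

lemma dirichlet_conv_factor_pairs:
  assumes "n > 0"
  shows "dirichlet_conv f g n = (\<Sum>(a, b) | a * b = n. f a * g b)"
  using assms unfolding dirichlet_conv_def
  by (auto intro!: sum.reindex_bij_witness[of _ fst "\<lambda>d. (d, n div d)"])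

lemma finite_factor_pairs:
  fixes n :: nat
  assumes "n > 0"
  shows "finite {(a, b). a * b = n}"
proof (rule finite_subset)
  show "{(a, b). a * b = n} \<subseteq> {..n} \<times> {..n}"
    using assms by auto
qed simp

lemma dirichlet_conv_commute: "dirichlet_conv f g = dirichlet_conv g f"
proof (rule arith_funs_eqI)
  fix n :: nat assume "n > 0"
  then show "dirichlet_conv f g n = dirichlet_conv g f n"
    by (auto simp: dirichlet_conv_factor_pairs mult.commute
        intro!: sum.reindex_bij_witness[of _ prod.swap prod.swap])
qed simp_all

text \<open>Both sides are the sum of f(a) g(b) h(c) over all triples with a * b * c = n; they
  differ only in which two factors are grouped first.\<close>

lemma dirichlet_conv_assoc:
  "dirichlet_conv (dirichlet_conv f g) h = dirichlet_conv f (dirichlet_conv g h)"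
proof (rule arith_funs_eqI)
  fix n :: nat assume n: "n > 0"
  let ?P = "\<lambda>n :: nat. {(a, b). a * b = n}"
  have fin: "finite (?P m)" if "m > 0" for m
    using finite_factor_pairs[OF that] .
  \<comment> \<open>The inner convolution is evaluated at a factor of n, and its pair form is
    available only at positive arguments.\<close>
  have pos: "fst x > 0" "snd x > 0" if "x \<in> ?P n" for x
    using that n by (auto intro: Nat.gr0I)
  have "dirichlet_conv (dirichlet_conv f g) h n =
      (\<Sum>x\<in>?P n. \<Sum>y\<in>?P (fst x). f (fst y) * g (snd y) * h (snd x))"
    unfolding dirichlet_conv_factor_pairs[OF n]
    using pos by (intro sum.cong)
      (force simp: dirichlet_conv_factor_pairs sum_distrib_right split_beta)+
  also have "\<dots> = (\<Sum>(x, y)\<in>Sigma (?P n) (\<lambda>x. ?P (fst x)). f (fst y) * g (snd y) * h (snd x))"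
    using fin n pos by (intro sum.Sigma) blast+
  also have "\<dots> = (\<Sum>(x, y)\<in>Sigma (?P n) (\<lambda>x. ?P (snd x)). f (fst x) * (g (fst y) * h (snd y)))"
    \<comment> \<open>A triple (a, b, c) is coded as ((a * b, c), (a, b)) on the left and as ((a, b
      * c), (b, c)) on the right; the witnesses translate between the codes.\<close>
    by (rule sum.reindex_bij_witness[of _
          "\<lambda>(x, y). ((fst x * fst y, snd y), (fst x, fst y))"
          "\<lambda>(x, y). ((fst y, snd y * snd x), (snd y, snd x))"]) (auto simp: mult.assoc)
  also have "\<dots> = (\<Sum>x\<in>?P n. \<Sum>y\<in>?P (snd x). f (fst x) * (g (fst y) * h (snd y)))"
    using fin n pos by (intro sum.Sigma [symmetric]) blast+
  also have "\<dots> = dirichlet_conv f (dirichlet_conv g h) n"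
    unfolding dirichlet_conv_factor_pairs[OF n]
    using pos by (intro sum.cong)
      (force simp: dirichlet_conv_factor_pairs sum_distrib_left split_beta)+
  finally show "dirichlet_conv (dirichlet_conv f g) h n = dirichlet_conv f (dirichlet_conv g h) n" .
qed simp_all

lemma dirichlet_conv_one:
  assumes "f \<in> arith_funs"
  shows "dirichlet_conv (\<lambda>n\<in>{0<..}. if n = 1 then 1 else 0) f = f"
proof (rule arith_funs_eqI)
  fix n :: nat assume n: "n > 0"
  have "dirichlet_conv (\<lambda>n\<in>{0<..}. if n = 1 then 1 else 0) f n =
      (\<Sum>d | d dvd n. if d = 1 then f n else 0)"
    using n unfolding dirichlet_conv_def
    by (simp only: restrict_apply greaterThan_iff if_True) (rule sum.cong; auto dest: dvd_pos_nat)
  also have "\<dots> = f n"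
    using n by (simp add: sum.delta)
  finally show "dirichlet_conv (\<lambda>n\<in>{0<..}. if n = 1 then 1 else 0) f n = f n" .
qed (simp_all add: assms)

lemma dirichlet_conv_add_left:
  "dirichlet_conv (\<lambda>n\<in>{0<..}. f n + g n) h =
     (\<lambda>n\<in>{0<..}. dirichlet_conv f h n + dirichlet_conv g h n)"
  by (rule arith_funs_eqI)
    (auto simp: dirichlet_conv_def sum.distrib [symmetric] distrib_right
      intro!: sum.cong dest: dvd_pos_nat)

lemma dirichlet_conv_smult_left:
  "dirichlet_conv (\<lambda>n\<in>{0<..}. c * f n) h = (\<lambda>n\<in>{0<..}. c * dirichlet_conv f h n)"
  by (rule arith_funs_eqI)
    (auto simp: dirichlet_conv_def sum_distrib_left mult.assoc
      intro!: sum.cong dest: dvd_pos_nat)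

lemma xi_nonzero [simp]: "xi n \<noteq> 0"
  by (simp add: xi_def)

lemma xi_one [simp]: "xi 1 = 1"
  by (simp add: xi_def)

text \<open>Additional primes contribute \<open>fact 0\<close>, which is 1. This allows
  \<open>xi\<close> of several numbers to be written over one common set of primes.\<close>

lemma xi_eq_prod_superset:
  assumes "finite A" "prime_factors n \<subseteq> A" "\<And>p. p \<in> A \<Longrightarrow> prime p"
  shows "xi n = (\<Prod>p\<in>A. fact (multiplicity p n))"
  unfolding xi_def using assms
  by (intro prod.mono_neutral_left) (auto simp: prime_factors_multiplicity)

text \<open>Multiplicities add under multiplication, so at each prime this is (k choose i) * i! * (k
  - i)! = k!. Without quotients the identity stays in the naturals.\<close>

lemma prod_choose_eq_xi:
  assumes "a > 0" "b > 0"
  shows "(\<Prod>p\<in>prime_factors (a * b). multiplicity p (a * b) choose multiplicity p a) * (xi a * xi b)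
    = xi (a * b)"
proof -
  let ?A = "prime_factors (a * b)"
  have xi: "xi m = (\<Prod>p\<in>?A. fact (multiplicity p m))" if "m dvd a * b" for m
    using that assms by (intro xi_eq_prod_superset dvd_prime_factors) auto
  have "(multiplicity p (a * b) choose multiplicity p a) *
      (fact (multiplicity p a) * fact (multiplicity p b)) = fact (multiplicity p (a * b))"
    if "p \<in> ?A" for p
  proof -
    have "multiplicity p (a * b) = multiplicity p a + multiplicity p b"
      using that assms by (intro prime_elem_multiplicity_mult_distrib) auto
    then show ?thesis
      using binomial_fact_lemma[of "multiplicity p a" "multiplicity p (a * b)"]
      by (simp add: mult_ac)
  qed
  then show ?thesis
    by (simp add: xi prod.distrib [symmetric])
qed

lemma times_xi_quot_xi [simp]: "f \<in> arith_funs \<Longrightarrow> times_xi (quot_xi f) = f"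
  by (rule arith_funs_eqI) (auto simp: times_xi_def quot_xi_def)

lemma quot_xi_times_xi [simp]: "f \<in> arith_funs \<Longrightarrow> quot_xi (times_xi f) = f"
  by (rule arith_funs_eqI) (auto simp: times_xi_def quot_xi_def)

lemma quot_xi_add:
  "quot_xi (\<lambda>n\<in>{0<..}. f n + g n) = (\<lambda>n\<in>{0<..}. quot_xi f n + quot_xi g n)"
  by (rule arith_funs_eqI) (auto simp: quot_xi_def add_divide_distrib)

lemma times_xi_add:
  "times_xi (\<lambda>n\<in>{0<..}. f n + g n) = (\<lambda>n\<in>{0<..}. times_xi f n + times_xi g n)"
  by (rule arith_funs_eqI) (auto simp: times_xi_def distrib_left)

lemma quot_xi_smult: "quot_xi (\<lambda>n\<in>{0<..}. c * f n) = (\<lambda>n\<in>{0<..}. c * quot_xi f n)"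
  by (rule arith_funs_eqI) (auto simp: quot_xi_def)

lemma times_xi_smult: "times_xi (\<lambda>n\<in>{0<..}. c * f n) = (\<lambda>n\<in>{0<..}. c * times_xi f n)"
  by (rule arith_funs_eqI) (auto simp: times_xi_def)

text \<open>Only the value at 1 matters, where \<open>xi\<close> is 1. \<open>One_nat_def\<close> is
  removed so that the simplifier keeps the 1 on which \<open>xi_one\<close> is stated.\<close>

lemma quot_xi_one:
  "quot_xi (\<lambda>n\<in>{0<..}. if n = 1 then 1 else 0) = (\<lambda>n\<in>{0<..}. if n = 1 then 1 else 0)"
  by (rule arith_funs_eqI) (use xi_one in \<open>auto simp: quot_xi_def simp del: One_nat_def\<close>)

text \<open>The sums agree term by term: for n = d * e, the nonzero \<open>xi d\<close> and
  \<open>xi e\<close> cancel against the denominators in \<open>quot_xi\<close>, and the binomial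
  weight remains.\<close>

lemma binomial_conv_eq: "binomial_conv f g = times_xi (dirichlet_conv (quot_xi f) (quot_xi g))"
proof (rule arith_funs_eqI)
  fix n :: nat assume n: "n > 0"
  have "of_nat (\<Prod>p\<in>prime_factors n. multiplicity p n choose multiplicity p d) * f d * g (n div d)
      = of_nat (xi n) * (quot_xi f d * quot_xi g (n div d))" if d: "d dvd n" for d
  proof -
    from d obtain e where e: "n = d * e" ..
    with n have pos: "d > 0" "e > 0" by auto
    have "complex_of_nat (xi n) =
        of_nat (\<Prod>p\<in>prime_factors n. multiplicity p n choose multiplicity p d)
          * (of_nat (xi d) * of_nat (xi e))"
      unfolding e prod_choose_eq_xi[OF pos, symmetric] by (simp only: of_nat_mult)
    with pos show ?thesis
      by (simp add: e quot_xi_def)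
  qed
  with n show "binomial_conv f g n = times_xi (dirichlet_conv (quot_xi f) (quot_xi g)) n"
    by (simp add: binomial_conv_def times_xi_def dirichlet_conv_def sum_distrib_left)
qed simp_all

text \<open>Serves both algebras, since they differ only in the product. Commutativity lets
  one-sided laws suffice; only the unit law asks for f in \<open>arith_funs\<close>, because a value
  of \<open>conv\<close> is always extensional.\<close>

lemma algebra_conv_algebra:
  assumes closed: "\<And>f g. conv f g \<in> arith_funs"
    and assoc: "\<And>f g h. conv (conv f g) h = conv f (conv g h)"
    and commute: "\<And>f g. conv f g = conv g f"
    and one: "\<And>f. f \<in> arith_funs \<Longrightarrow> conv (\<lambda>n\<in>{0<..}. if n = 1 then 1 else 0) f = f"
    and add: "\<And>f g h. conv (\<lambda>n\<in>{0<..}. f n + g n) h = (\<lambda>n\<in>{0<..}. conv f h n + conv g h n)"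
    and smult: "\<And>c f h. conv (\<lambda>n\<in>{0<..}. c * f n) h = (\<lambda>n\<in>{0<..}. c * conv f h n)"
  shows "algebra complex_ring (conv_algebra conv)"
proof (rule algebraI)
  have "abelian_group (conv_algebra conv)"
  proof (rule abelian_groupI)
    fix f assume "f \<in> carrier (conv_algebra conv)"
    then show "\<exists>g\<in>carrier (conv_algebra conv).
        g \<oplus>\<^bsub>conv_algebra conv\<^esub> f = \<zero>\<^bsub>conv_algebra conv\<^esub>"
      by (intro bexI[of _ "\<lambda>n\<in>{0<..}. - f n"]) (auto simp: conv_algebra_def)
  qed (auto simp: conv_algebra_def algebra_simps intro: arith_funs_eqI)
  moreover have "comm_monoid (conv_algebra conv)"
    using closed assoc commute one by unfold_locales
      (auto simp: conv_algebra_def simp del: One_nat_def)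
  ultimately show "cring (conv_algebra conv)"
    by (rule cringI) (simp add: conv_algebra_def add)
qed (use cring_from_type_algebra in \<open>auto simp: conv_algebra_def ring_of_type_algebra_def
      smult algebra_simps intro: arith_funs_eqI\<close>)

lemma algebra_dirichlet_algebra: "algebra complex_ring dirichlet_algebra"
  unfolding dirichlet_algebra_def
  by (intro algebra_conv_algebra dirichlet_conv_assoc dirichlet_conv_commute dirichlet_conv_one
      dirichlet_conv_add_left dirichlet_conv_smult_left dirichlet_conv_in_arith_funs)

text \<open>Each law is rewritten by \<open>binomial_conv_eq\<close>; in a nested product the inner
  \<open>times_xi\<close> meets the outer \<open>quot_xi\<close> and cancels, which leaves the
  corresponding Dirichlet law.\<close>

lemma algebra_binomial_algebra: "algebra complex_ring binomial_algebra"
  unfolding binomial_algebra_def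
proof (rule algebra_conv_algebra)
  show "binomial_conv f g = binomial_conv g f" for f g
    by (simp only: binomial_conv_eq dirichlet_conv_commute[of "quot_xi f"])
qed (simp_all only: binomial_conv_eq quot_xi_times_xi times_xi_quot_xi dirichlet_conv_assoc
    dirichlet_conv_one quot_xi_one quot_xi_add quot_xi_smult times_xi_add times_xi_smult
    dirichlet_conv_add_left dirichlet_conv_smult_left
    dirichlet_conv_in_arith_funs quot_xi_in_arith_funs times_xi_in_arith_funs)

lemma quot_xi_algebra_iso:
  "quot_xi \<in> algebra_iso complex_ring binomial_algebra dirichlet_algebra"
proof -
  have "bij_betw quot_xi arith_funs arith_funs"
    by (rule bij_betw_byWitness[where f' = times_xi]) auto
  \<comment> \<open>Multiplicativity is \<open>binomial_conv_eq\<close> with \<open>quot_xi\<close>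
    applied to both sides.\<close>
  moreover have "quot_xi \<in> ring_hom binomial_algebra dirichlet_algebra"
    by (rule ring_hom_memI)
      (simp_all add: binomial_algebra_def dirichlet_algebra_def conv_algebra_def
        binomial_conv_eq quot_xi_add quot_xi_one del: One_nat_def)
  ultimately show ?thesis
    by (auto simp: algebra_iso_def ring_iso_def binomial_algebra_def dirichlet_algebra_def
        conv_algebra_def quot_xi_smult)
qed

theorem theorem2p1:
  shows "algebra complex_ring binomial_algebra \<and>
     algebra complex_ring dirichlet_algebra \<and>
     isomorphic_algebras complex_ring binomial_algebra dirichlet_algebra \<and>
     quot_xi \<in> algebra_iso complex_ring binomial_algebra dirichlet_algebra \<and>
     (\<forall>f\<in>arith_funs. \<forall>g\<in>arith_funs.
           binomial_conv f g = times_xi (dirichlet_conv (quot_xi f) (quot_xi g)))"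
  using algebra_binomial_algebra algebra_dirichlet_algebra quot_xi_algebra_iso binomial_conv_eq
  unfolding isomorphic_algebras_def by blast

end
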